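(* Let $t\ge 0$ be an integer. Suppose $F=F(x,y)\in\mathbb{Q}[x,y]$ satisfies the following two conditions: (i) $F$ is fixed by the automorphism $\sigma$ of $\mathbb{Q}[x,y]$ that sends $(x,y)\mapsto(-y,x)$; (ii) $x^{2\lceil t/2\rceil}y^{2\lceil t/2\rceil}$ divides $F$ in $\mathbb{Q}[x,y]$. Then the integral $$\int_{\Delta}\frac{F\,dx\,dy}{(1-x^2-y^2)^{t+1}}$$ over the simplex $\Delta=\{(x,y)\in\mathbb{R}^2 : x,\ y,\ 1-x-y\ge 0\}$ converges to a $\mathbb{Q}$-linear combination of $1$ and $\mathbf{G}$.
   Context: $\mathbf{G}=1-\frac1{3^2}+\frac1{5^2}-\frac1{7^2}+\cdots=L(2,\chi_{-4})$ is the Catalan constant. $\lceil\cdot\rceil$ is the ceiling function. $\sigma$ is the $\mathbb{Q}$-algebra automorphism with $\sigma(x)=-y$, $\sigma(y)=x$. *)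

theory Defs
  imports "HOL-Analysis.Analysis" "HOL-Computational_Algebra.Polynomial"
begin

text \<open>
  The ring \<open>\<rat>[x, y]\<close> is the type \<^typ>\<open>rat poly poly\<close>: the inner indeterminate is \<open>x\<close>,
  the outer one is \<open>y\<close>.
\<close>

type_synonym rat_poly2 = "rat poly poly"

definition const2 :: "rat \<Rightarrow> rat_poly2" where
  "const2 q = [:[:q:]:]"

definition var_x :: rat_poly2 where
  "var_x = [:[:0, 1:]:]"

definition var_y :: rat_poly2 where
  "var_y = [:0, 1:]"

text \<open>
  Substitution \<open>x \<mapsto> a\<close>, \<open>y \<mapsto> b\<close> into a commutative ring, with the rational coefficients
  carried over along \<open>h\<close>.
\<close>

definition subst2 :: "(rat \<Rightarrow> 'a) \<Rightarrow> 'a \<Rightarrow> 'a \<Rightarrow> rat_poly2 \<Rightarrow> 'a::comm_ring_1" where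
  "subst2 h a b F = poly (map_poly (\<lambda>c. poly (map_poly h c) a) F) b"

definition eval2 :: "rat_poly2 \<Rightarrow> real \<Rightarrow> real \<Rightarrow> real" where
  "eval2 F x y = subst2 of_rat x y F"

definition sigma_aut :: "rat_poly2 \<Rightarrow> rat_poly2" where
  "sigma_aut = subst2 const2 (- var_y) var_x"

definition std_triangle :: "(real \<times> real) set" where
  "std_triangle = {(x, y). x \<ge> 0 \<and> y \<ge> 0 \<and> 1 - x - y \<ge> 0}"

definition catalan_const :: real where
  "catalan_const = (\<Sum>n. (-1) ^ n / (2 * real n + 1) ^ 2)"

text \<open>The series for Catalan's constant converges.\<close>

lemma summable_catalan_const: "summable (\<lambda>n. (-1) ^ n / (2 * real n + 1) ^ 2)"
proof (rule summable_comparison_test')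
  show "summable (\<lambda>n. 1 / (real (Suc n)) ^ 2)"
    using inverse_squares_sums by (simp add: sums_iff)
  show "norm ((-1) ^ n / (2 * real n + 1) ^ 2) \<le> 1 / (real (Suc n)) ^ 2" for n :: nat
    by (simp add: norm_divide norm_power frac_le power_mono)
qed

text \<open>
  \<^const>\<open>subst2\<close> is a ring homomorphism, and \<^const>\<open>sigma_aut\<close> is the \<open>\<rat>\<close>-algebra automorphism
  of \<open>\<rat>[x, y]\<close> with \<open>x \<mapsto> -y\<close> and \<open>y \<mapsto> x\<close>.
\<close>

definition ring_hom_fun :: "('a::comm_ring_1 \<Rightarrow> 'b::comm_ring_1) \<Rightarrow> bool" where
  "ring_hom_fun h \<longleftrightarrow>
     h 1 = 1 \<and> (\<forall>p q. h (p + q) = h p + h q) \<and> (\<forall>p q. h (p * q) = h p * h q)"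

lemma ring_hom_fun_0:
  assumes "ring_hom_fun h"
  shows "h 0 = 0"
proof -
  have "h (0 + 0) = h 0 + h 0"
    using assms unfolding ring_hom_fun_def by blast
  then show ?thesis by simp
qed

lemma poly_map_poly_pCons:
  assumes "ring_hom_fun h"
  shows "poly (map_poly h (pCons c p)) a = h c + a * poly (map_poly h p) a"
  using ring_hom_fun_0[OF assms] by (simp add: map_poly_pCons)

lemma ring_hom_fun_poly_map_poly:
  assumes h: "ring_hom_fun h"
  shows "ring_hom_fun (\<lambda>p. poly (map_poly h p) a)"
proof -
  note h0 = ring_hom_fun_0[OF h]
  note hs = h[unfolded ring_hom_fun_def]
  note pC = poly_map_poly_pCons[OF h]
  have one: "poly (map_poly h 1) a = 1"
    using pC[of 1 0] hs by (simp add: one_pCons)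
  have add: "poly (map_poly h (p + q)) a = poly (map_poly h p) a + poly (map_poly h q) a" for p q
    by (induction p q rule: poly_induct2) (simp_all add: pC hs algebra_simps)
  have smult: "poly (map_poly h (smult c q)) a = h c * poly (map_poly h q) a" for c q
    by (induction q) (simp_all add: pC hs algebra_simps)
  have mult: "poly (map_poly h (p * q)) a = poly (map_poly h p) a * poly (map_poly h q) a" for p q
    by (induction p) (simp_all add: pC add smult h0 algebra_simps)
  show ?thesis
    unfolding ring_hom_fun_def using one add mult by blast
qed

lemma ring_hom_fun_subst2:
  assumes "ring_hom_fun h"
  shows "ring_hom_fun (subst2 h a b)"
  unfolding subst2_def
  by (intro ring_hom_fun_poly_map_poly assms)

lemma subst2_generators:
  assumes "ring_hom_fun h"
  shows "subst2 h a b (const2 q) = h q" "subst2 h a b var_x = a" "subst2 h a b var_y = b"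
proof -
  note 1 = poly_map_poly_pCons[OF assms]
  note 2 = poly_map_poly_pCons[OF ring_hom_fun_poly_map_poly[OF assms]]
  have "h 1 = 1" using assms by (simp add: ring_hom_fun_def)
  then show "subst2 h a b (const2 q) = h q" "subst2 h a b var_x = a" "subst2 h a b var_y = b"
    using ring_hom_fun_0[OF assms]
    by (simp_all add: subst2_def const2_def var_x_def var_y_def 1 2 one_pCons)
qed

lemma ring_hom_fun_const2: "ring_hom_fun const2"
  by (simp add: ring_hom_fun_def const2_def one_pCons)

lemma ring_hom_fun_sigma_aut: "ring_hom_fun sigma_aut"
  unfolding sigma_aut_def by (intro ring_hom_fun_subst2 ring_hom_fun_const2)

lemma sigma_aut_generators: "sigma_aut (const2 q) = const2 q" "sigma_aut var_x = - var_y" "sigma_aut var_y = var_x"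
  by (simp_all add: sigma_aut_def subst2_generators[OF ring_hom_fun_const2])

lemma rat_poly2_hom_unique:
  assumes f: "ring_hom_fun f" and g: "ring_hom_fun g"
    and eq: "\<And>q. f (const2 q) = g (const2 q)" "f var_x = g var_x" "f var_y = g var_y"
  shows "f F = g F"
proof -
  note fs = f[unfolded ring_hom_fun_def] and gs = g[unfolded ring_hom_fun_def]
  have inner: "f [:c:] = g [:c:]" for c
  proof (induction c)
    case 0
    show ?case using ring_hom_fun_0[OF f] ring_hom_fun_0[OF g] by simp
  next
    case (pCons q c)
    have "[:pCons q c:] = const2 q + var_x * [:c:]"
      by (simp add: const2_def var_x_def)
    then show ?case by (simp only: fs gs eq pCons.IH)
  qed
  show ?thesis
  proof (induction F)
    case 0
    show ?case using ring_hom_fun_0[OF f] ring_hom_fun_0[OF g] by simp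
  next
    case (pCons c F)
    have "pCons c F = [:c:] + var_y * F"
      by (simp add: var_y_def)
    then show ?case by (simp only: fs gs eq inner pCons.IH)
  qed
qed

lemma bij_sigma_aut: "bij sigma_aut"
proof -
  have comp: "ring_hom_fun (\<lambda>F. f (g F))" if "ring_hom_fun f" "ring_hom_fun g"
    for f g :: "rat_poly2 \<Rightarrow> rat_poly2"
    using that by (simp add: ring_hom_fun_def)
  have neg: "sigma_aut (- F) = - sigma_aut F" for F
  proof -
    have "sigma_aut (- F + F) = sigma_aut (- F) + sigma_aut F"
      using ring_hom_fun_sigma_aut unfolding ring_hom_fun_def by blast
    then show ?thesis
      using ring_hom_fun_0[OF ring_hom_fun_sigma_aut] by (simp add: eq_neg_iff_add_eq_0)
  qed
  have id: "ring_hom_fun (\<lambda>F :: rat_poly2. F)"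
    by (simp add: ring_hom_fun_def)
  have "sigma_aut (sigma_aut (sigma_aut (sigma_aut F))) = F" for F
    by (rule rat_poly2_hom_unique[OF comp[OF ring_hom_fun_sigma_aut comp[OF ring_hom_fun_sigma_aut
          comp[OF ring_hom_fun_sigma_aut ring_hom_fun_sigma_aut]]] id])
       (simp_all add: sigma_aut_generators neg)
  then show ?thesis
    by (intro bij_betw_byWitness[where f' = "\<lambda>F. sigma_aut (sigma_aut (sigma_aut F))"]) auto
qed

lemma eval2_hom:
  "eval2 (F + G) x y = eval2 F x y + eval2 G x y"
  "eval2 (F * G) x y = eval2 F x y * eval2 G x y"
  "eval2 (const2 q) x y = of_rat q" "eval2 var_x x y = x" "eval2 var_y x y = y"
proof -
  have r: "ring_hom_fun (of_rat :: rat \<Rightarrow> real)"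
    by (simp add: ring_hom_fun_def of_rat_add of_rat_mult)
  show "eval2 (F + G) x y = eval2 F x y + eval2 G x y"
    "eval2 (F * G) x y = eval2 F x y * eval2 G x y"
    using ring_hom_fun_subst2[OF r, of x y] by (simp_all add: eval2_def ring_hom_fun_def)
  show "eval2 (const2 q) x y = of_rat q" "eval2 var_x x y = x" "eval2 var_y x y = y"
    by (simp_all add: eval2_def subst2_generators[OF r])
qed

end

theory Submission
  imports Defs "HOL-Real_Asymp.Real_Asymp"
begin

text \<open>
  Write \<open>Q = 1 - x\<^sup>2 - y\<^sup>2\<close> and let \<open>period a b t\<close> be the integral of \<open>x ^ a * y ^ b / Q ^ (t + 1)\<close> over the
  triangle. On the triangle \<open>Q \<ge> 2 x y\<close>, with equality on the hypotenuse. The divisibility hypothesis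
  implies that only \<open>a, b \<ge> t\<close> occur, and then the integrand is bounded by \<open>1 / Q\<close>; so everything converges
  once the integral of \<open>1 / Q\<close> does.

  The invariance hypothesis removes every monomial except those with even exponents. Indeed \<open>F\<close> is the
  average of its four rotations; for a monomial with exponents of different parity this average is zero,
  and for two odd exponents it is antisymmetric in \<open>x\<close> and \<open>y\<close>, so its integral vanishes because the
  triangle is symmetric (\<open>integral_orbit_sum\<close>). What has to be shown is therefore
  \<open>period (2 * A) (2 * B) t \<in> \<rat> + \<rat> G\<close> for \<open>t \<le> 2 * A\<close>, \<open>t \<le> 2 * B\<close>.

  These integrals satisfy linear relations modulo \<open>\<rat>\<close>. Green's formula applied to
  \<open>x ^ (a + 1) * y ^ b / Q ^ (t + 1)\<close> relates level \<open>t + 1\<close> to level \<open>t\<close> (\<open>period_stokes\<close>); the boundary term is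
  rational because \<open>Q = 2 x y\<close> cancels on the hypotenuse. The identity \<open>Q = 1 - x\<^sup>2 - y\<^sup>2\<close> itself gives
  a second relation (\<open>period_raise_level\<close>, \<open>period_0_relation\<close>). Together they reduce every
  \<open>period (2 * A) (2 * B) t\<close> first to level \<open>0\<close> (\<open>period_in_catalan_span\<close>) and then to \<open>period 0 0 0\<close>
  (\<open>period_0_recursion\<close>). Parity matters here: all steps change exponents by two.

  It remains to see that the integral of \<open>1 / Q\<close> is \<open>G\<close>. Integrating along the rays from the origin leaves
  an integral over the slope \<open>w\<close>, which by symmetry may be taken between \<open>0\<close> and \<open>1\<close>;
  the integrand becomes \<open>(- ln w + ln ((1 + w)\<^sup>2 / 2)) / (1 + w\<^sup>2)\<close>.
  The second logarithm contributes \<open>0\<close>, by the involution \<open>w \<mapsto> (1 - w) / (1 + w)\<close>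
  (\<open>has_integral_ln_square_half\<close>), and the first contributes \<open>G\<close>, by expanding \<open>1 / (1 + w\<^sup>2)\<close>
  in a geometric series (\<open>nn_integral_neg_ln_over_one_plus_square\<close>).
\<close>

section \<open>The integral of the reciprocal of \<open>1 - x\<^sup>2 - y\<^sup>2\<close>\<close>

text \<open>
  The antiderivatives below involve \<open>w * ln w\<close>, which is continuous but not differentiable at \<open>0\<close>;
  therefore differentiability is asked for in the open interval only.
\<close>

lemma nn_integral_FTC_interior:
  fixes f F :: "real \<Rightarrow> real"
  assumes "a \<le> b" and "continuous_on {a..b} F"
    and deriv: "\<And>x. x \<in> {a<..<b} \<Longrightarrow> (F has_real_derivative f x) (at x)"
    and nonneg: "\<And>x. x \<in> {a<..<b} \<Longrightarrow> 0 \<le> f x"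
  shows "(\<integral>\<^sup>+x. ennreal (f x) * indicator {a<..<b} x \<partial>lborel) = ennreal (F b - F a)"
proof -
  have "(f has_integral (F b - F a)) {a..b}"
    using assms
    by (intro fundamental_theorem_of_calculus_interior)
       (auto simp: has_real_derivative_iff_has_vector_derivative)
  then have "(f has_integral (F b - F a)) {a<..<b}"
    by (simp add: has_integral_Icc_iff_Ioo)
  then show ?thesis
    using nonneg by (intro nn_integral_has_integral_lebesgue') auto
qed

lemma AE_indicator_Icc_Ioo: "AE x in lborel. indicator {a..b} x = (indicator {a<..<b} x :: 'a::zero_neq_one)"
  for a b :: real
proof -
  have "AE x in lborel. x \<notin> {a, b}"
    by (rule AE_not_in) (auto intro!: finite_imp_null_set_lborel)
  then show ?thesis
    by eventually_elim (auto simp: indicator_def)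
qed

text \<open>
  The geometric series for \<open>1 / (1 + w\<^sup>2)\<close> alternates. Its terms are taken in consecutive pairs, so that
  each pair times \<open>- ln w\<close> is nonnegative on the unit interval and monotone convergence applies.
\<close>

lemma nn_integral_neg_ln_monomials:
  "(\<integral>\<^sup>+w. ennreal (- ln w * (w ^ n - w ^ (n + 2))) * indicator {0<..<1} w \<partial>lborel)
    = ennreal (1 / (real n + 1)\<^sup>2 - 1 / (real n + 3)\<^sup>2)"
proof -
  define P :: "nat \<Rightarrow> real \<Rightarrow> real" where
    "P = (\<lambda>m w. w ^ Suc m / (real m + 1)\<^sup>2 - ln w * w ^ Suc m / (real m + 1))"
  have cont: "continuous_on {0..1} (P m)" for m
  proof -
    have "continuous (at w within {0..1}) (P m)" if "w \<in> {0..1}" for w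
    proof (cases "w = 0")
      case True
      have "((\<lambda>w. ln w * w) \<longlongrightarrow> 0) (at_right (0::real))"
        by real_asymp
      then have "((\<lambda>w. ln w * w) \<longlongrightarrow> 0) (at (0::real) within {0..1})"
        by (subst at_within_Icc_at_right) auto
      then have "((\<lambda>w. w ^ Suc m / (real m + 1)\<^sup>2 - (ln w * w) * w ^ m / (real m + 1)) \<longlongrightarrow>
          0 ^ Suc m / (real m + 1)\<^sup>2 - 0 * 0 ^ m / (real m + 1)) (at 0 within {0..1})"
        by (intro tendsto_intros) auto
      then show ?thesis
        by (simp add: True continuous_within P_def mult_ac)
    next
      case False
      with that show ?thesis unfolding P_def by (intro continuous_intros) auto
    qed
    then show ?thesis by (simp add: continuous_on_eq_continuous_within)
  qed
  have deriv: "(P m has_real_derivative - ln w * w ^ m) (at w)" if "w > 0" for m w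
  proof -
    define c where "c = real m + 1"
    have c: "c > 0" by (simp add: c_def)
    have pw: "((\<lambda>w. w ^ Suc m) has_real_derivative c * w ^ m) (at w)"
      using DERIV_pow[of "Suc m" w] by (simp add: c_def add_ac)
    have "((\<lambda>w. w ^ Suc m / c\<^sup>2 - ln w * w ^ Suc m / c) has_real_derivative
        (c * w ^ m) / c\<^sup>2 - ((1 / w) * w ^ Suc m + (c * w ^ m) * ln w) / c) (at w)"
      using that by (intro DERIV_diff DERIV_cdivide DERIV_mult pw DERIV_ln_divide)
    moreover have "(c * w ^ m) / c\<^sup>2 - ((1 / w) * w ^ Suc m + (c * w ^ m) * ln w) / c = - ln w * w ^ m"
      using c that by (simp add: field_simps power2_eq_square)
    ultimately show ?thesis unfolding P_def c_def by simp
  qed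
  have "(\<integral>\<^sup>+w. ennreal (- ln w * (w ^ n - w ^ (n + 2))) * indicator {0<..<1} w \<partial>lborel)
      = ennreal ((P n 1 - P (n + 2) 1) - (P n 0 - P (n + 2) 0))"
  proof (rule nn_integral_FTC_interior)
    fix w :: real assume w: "w \<in> {0<..<1}"
    then have "((\<lambda>w. P n w - P (n + 2) w) has_real_derivative - ln w * w ^ n - - ln w * w ^ (n + 2)) (at w)"
      by (intro DERIV_diff deriv) auto
    then show "((\<lambda>w. P n w - P (n + 2) w) has_real_derivative - ln w * (w ^ n - w ^ (n + 2))) (at w)"
      by (simp add: algebra_simps)
    show "0 \<le> - ln w * (w ^ n - w ^ (n + 2))"
      using w power_decreasing[of n "n + 2" w] by (intro mult_nonneg_nonneg) simp_all
  qed (auto intro!: continuous_intros cont)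
  then show ?thesis
    by (simp add: P_def add_ac)
qed

lemma catalan_pairs_sums:
  "(\<lambda>k. 1 / (real (4 * k) + 1)\<^sup>2 - 1 / (real (4 * k) + 3)\<^sup>2) sums catalan_const"
proof -
  have "(\<lambda>n. (-1) ^ n / (2 * real n + 1) ^ 2) sums catalan_const"
    unfolding catalan_const_def using summable_catalan_const by (rule summable_sums)
  from sums_group[OF this, of 2]
  have "(\<lambda>k. \<Sum>n = k * 2..<k * 2 + 2. (-1) ^ n / (2 * real n + 1)\<^sup>2) sums catalan_const"
    by simp
  moreover have "(\<Sum>n = k * 2..<k * 2 + 2. (-1) ^ n / (2 * real n + 1)\<^sup>2)
      = 1 / (real (4 * k) + 1)\<^sup>2 - 1 / (real (4 * k) + 3)\<^sup>2" for k
  proof -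
    have "{k * 2..<k * 2 + 2} = {2 * k, 2 * k + 1}" by auto
    then show ?thesis by (simp add: power_mult[of _ 2] mult.commute[of k] add_ac)
  qed
  ultimately show ?thesis by (simp add: add_ac)
qed

lemma catalan_const_nonneg: "0 \<le> catalan_const"
  by (rule sums_le[OF _ sums_zero catalan_pairs_sums]) (auto intro!: frac_le power_mono)

lemma nn_integral_neg_ln_over_one_plus_square:
  "(\<integral>\<^sup>+w. ennreal (- ln w / (1 + w\<^sup>2)) * indicator {0<..<1} w \<partial>lborel) = ennreal catalan_const"
proof -
  let ?f = "\<lambda>k w :: real. ennreal (- ln w * (w ^ (4 * k) - w ^ (4 * k + 2))) * indicator {0<..<1} w"
  have nn: "0 \<le> - ln w * (w ^ (4 * k) - w ^ (4 * k + 2))" if "w \<in> {0<..<1}" for k and w :: real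
    using that power_decreasing[of "4 * k" "4 * k + 2" w] by (intro mult_nonneg_nonneg) simp_all
  have "ennreal (- ln w / (1 + w\<^sup>2)) * indicator {0<..<1} w = (\<Sum>k. ?f k w)" for w
  proof (cases "w \<in> {0<..<1}")
    case True
    have eq: "- ln w * (1 - w\<^sup>2) * (1 / (1 - w ^ 4)) = - ln w / (1 + w\<^sup>2)"
    proof -
      have "w\<^sup>2 < 1" using True by (simp add: power_less_one_iff)
      moreover have "1 - w ^ 4 = (1 - w\<^sup>2) * (1 + w\<^sup>2)"
        by (simp add: power2_eq_square power4_eq_xxxx algebra_simps)
      ultimately show ?thesis by simp
    qed
    have "(\<lambda>k. (w ^ 4) ^ k) sums (1 / (1 - w ^ 4))"
      using True by (intro geometric_sums) (simp add: power_less_one_iff)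
    from sums_mult[OF this, of "- ln w * (1 - w\<^sup>2)"]
    have "(\<lambda>k. - ln w * (1 - w\<^sup>2) * (w ^ 4) ^ k) sums (- ln w / (1 + w\<^sup>2))"
      unfolding eq .
    moreover have "- ln w * (1 - w\<^sup>2) * (w ^ 4) ^ k = - ln w * (w ^ (4 * k) - w ^ (4 * k + 2))" for k
      unfolding power_mult power_add by algebra
    ultimately have "(\<lambda>k. - ln w * (w ^ (4 * k) - w ^ (4 * k + 2))) sums (- ln w / (1 + w\<^sup>2))"
      by (simp only:)
    then have "(\<Sum>k. ennreal (- ln w * (w ^ (4 * k) - w ^ (4 * k + 2)))) = ennreal (- ln w / (1 + w\<^sup>2))"
      using nn[OF True] by (intro suminf_ennreal_eq)
    then show ?thesis using True by simp
  qed simp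
  then have "(\<integral>\<^sup>+w. ennreal (- ln w / (1 + w\<^sup>2)) * indicator {0<..<1} w \<partial>lborel)
      = (\<integral>\<^sup>+w. (\<Sum>k. ?f k w) \<partial>lborel)"
    by simp
  also have "\<dots> = (\<Sum>k. \<integral>\<^sup>+w. ?f k w \<partial>lborel)"
    by (intro nn_integral_suminf) measurable
  also have "\<dots> = (\<Sum>k. ennreal (1 / (real (4 * k) + 1)\<^sup>2 - 1 / (real (4 * k) + 3)\<^sup>2))"
    by (simp only: nn_integral_neg_ln_monomials)
  also have "\<dots> = ennreal catalan_const"
    by (intro suminf_ennreal_eq catalan_pairs_sums) (auto intro!: frac_le power_mono)
  finally show ?thesis .
qed

text \<open>
  The substitution \<open>w \<mapsto> (1 - w) / (1 + w)\<close> is an involution of the unit interval that preserves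
  \<open>dw / (1 + w\<^sup>2)\<close> up to orientation and sends \<open>1 + w\<close> to \<open>2 / (1 + w)\<close>. It thus changes the sign of the
  logarithm, and the integral equals its own negative.
\<close>

lemma has_integral_ln_square_half:
  "((\<lambda>w. ln ((1 + w)\<^sup>2 / 2) / (1 + w\<^sup>2)) has_integral 0) {0..1::real}"
proof -
  define h :: "real \<Rightarrow> real" where "h = (\<lambda>w. ln ((1 + w)\<^sup>2 / 2) / (1 + w\<^sup>2))"
  have pos: "1 + w\<^sup>2 \<noteq> 0" for w :: real by (metis add_pos_nonneg less_numeral_extra(1) zero_le_power2 less_irrefl)
  have cont: "continuous_on {0..1} h"
    unfolding h_def using pos by (intro continuous_intros) auto
  have "((\<lambda>w. (- 2 / (1 + w)\<^sup>2) *\<^sub>R h ((1 - w) / (1 + w))) has_integral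
      (integral {(1 - 0) / (1 + 0)..(1 - 1) / (1 + 1)} h - integral {(1 - 1) / (1 + 1)..(1 - 0) / (1 + 0)} h)) {0..1::real}"
  proof (rule has_integral_substitution_general[of "{}" 0 1 _ 0 1 h])
    show "(\<lambda>w. (1 - w) / (1 + w)) ` {0..1} \<subseteq> {0..1::real}"
      by (auto simp: divide_simps)
    show "continuous_on {0..1} (\<lambda>w::real. (1 - w) / (1 + w))"
      by (intro continuous_intros) auto
    show "((\<lambda>w. (1 - w) / (1 + w)) has_real_derivative - 2 / (1 + w)\<^sup>2) (at w within {0..1})"
      if "w \<in> {0..1} - {}" for w :: real
      using that by (auto intro!: derivative_eq_intros simp: power2_eq_square divide_simps)
  qed (use cont in auto)
  then have "((\<lambda>w. (- 2 / (1 + w)\<^sup>2) *\<^sub>R h ((1 - w) / (1 + w))) has_integral - integral {0..1} h) {0..1}"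
    by simp
  moreover have "(- 2 / (1 + w)\<^sup>2) *\<^sub>R h ((1 - w) / (1 + w)) = h w" if "w \<in> {0..1}" for w
  proof -
    have w: "1 + w > 0" using that by simp
    have a: "1 + (1 - w) / (1 + w) = 2 / (1 + w)" using w by (simp add: field_simps)
    have b: "1 + ((1 - w) / (1 + w))\<^sup>2 = 2 * (1 + w\<^sup>2) / (1 + w)\<^sup>2"
      using w by (simp add: divide_simps power2_eq_square) (simp add: algebra_simps)
    have "ln ((2 / (1 + w))\<^sup>2 / 2) = - ln ((1 + w)\<^sup>2 / 2)"
      using w by (subst ln_inverse[symmetric]) (auto simp: power2_eq_square)
    then show ?thesis
      unfolding h_def a b using w pos[of w] by (simp add: divide_simps)
  qed
  ultimately have "(h has_integral - integral {0..1} h) {0..1}"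
    by (subst has_integral_cong[symmetric]) auto
  then have "(h has_integral 0) {0..1}"
    using integral_unique[of h "- integral {0..1} h" "{0..1}"] by simp
  then show ?thesis
    unfolding h_def .
qed

lemma nn_integral_catalan_on_unit_interval:
  "(\<integral>\<^sup>+w. ennreal (- ln (2 * w / (1 + w)\<^sup>2) / (1 + w\<^sup>2)) * indicator {0<..<1} w \<partial>lborel)
    = ennreal catalan_const"
proof -
  have "((\<lambda>w. (- ln w / (1 + w\<^sup>2)) * indicator {0<..<1} w) has_integral catalan_const) UNIV"
  proof (rule nn_integral_has_integral)
    show "0 \<le> - ln w / (1 + w\<^sup>2) * indicator {0<..<1} w" for w :: real
      by (auto simp: indicator_def intro!: divide_nonneg_pos add_pos_nonneg divide_nonpos_pos)
    show "(\<integral>\<^sup>+w. ennreal (- ln w / (1 + w\<^sup>2) * indicator {0<..<1} w) \<partial>lborel) = ennreal catalan_const"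
      unfolding nn_integral_neg_ln_over_one_plus_square[symmetric]
      by (intro nn_integral_cong) (auto simp: indicator_def)
  qed (use catalan_const_nonneg in auto)
  then have "((\<lambda>w. if w \<in> {0<..<1} then - ln w / (1 + w\<^sup>2) else 0) has_integral catalan_const) UNIV"
    by (rule has_integral_eq[rotated]) auto
  then have "((\<lambda>w. - ln w / (1 + w\<^sup>2)) has_integral catalan_const) {0<..<1}"
    by (simp only: has_integral_restrict_UNIV)
  moreover have "((\<lambda>w. ln ((1 + w)\<^sup>2 / 2) / (1 + w\<^sup>2)) has_integral 0) {0<..<1::real}"
    using has_integral_ln_square_half by (simp add: has_integral_Icc_iff_Ioo)
  ultimately have "((\<lambda>w. - ln w / (1 + w\<^sup>2) + ln ((1 + w)\<^sup>2 / 2) / (1 + w\<^sup>2)) has_integral catalan_const + 0) {0<..<1}"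
    by (rule has_integral_add)
  moreover have "- ln w / (1 + w\<^sup>2) + ln ((1 + w)\<^sup>2 / 2) / (1 + w\<^sup>2) = - ln (2 * w / (1 + w)\<^sup>2) / (1 + w\<^sup>2)"
    if "w \<in> {0<..<1}" for w :: real
    using that by (simp add: ln_div ln_mult diff_divide_distrib add_divide_distrib)
  ultimately have "((\<lambda>w. - ln (2 * w / (1 + w)\<^sup>2) / (1 + w\<^sup>2)) has_integral catalan_const) {0<..<1}"
    by (subst has_integral_cong[symmetric]) auto
  then show ?thesis
  proof (intro nn_integral_has_integral_lebesgue')
    fix w :: real assume w: "w \<in> {0<..<1}"
    have "2 * w / (1 + w)\<^sup>2 \<le> 1"
      using w by (simp add: divide_simps power2_eq_square algebra_simps)
    then show "0 \<le> - ln (2 * w / (1 + w)\<^sup>2) / (1 + w\<^sup>2)"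
      using w by (intro divide_nonneg_pos) (auto intro!: add_pos_nonneg)
  qed
qed

lemma sets_std_triangle [measurable]: "std_triangle \<in> sets borel"
proof -
  have "closed std_triangle"
    unfolding std_triangle_def case_prod_beta
    by (intro closed_Collect_conj closed_Collect_le continuous_intros)
  then show ?thesis by (rule borel_closed)
qed

text \<open>
  In the coordinates \<open>x = s * p\<close>, \<open>y = s * (1 - p)\<close> the triangle becomes the unit square. The change of
  variables is done in two one-dimensional steps, the shear \<open>y = s - x\<close> for fixed \<open>x\<close> and the scaling
  \<open>x = s * p\<close> for fixed \<open>s\<close>, with an exchange of the order of integration after each of them.
\<close>

lemma nn_integral_std_triangle_scaling:
  fixes f :: "real \<Rightarrow> real \<Rightarrow> ennreal"
  assumes [measurable]: "(\<lambda>z. f (fst z) (snd z)) \<in> borel_measurable borel"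
  shows "(\<integral>\<^sup>+z. f (fst z) (snd z) * indicator std_triangle z \<partial>lborel)
    = (\<integral>\<^sup>+p. (\<integral>\<^sup>+s. ennreal s * f (s * p) (s * (1 - p)) * indicator {0<..<1} s \<partial>lborel)
          * indicator {0<..<1} p \<partial>lborel)"
proof -
  have fm [measurable]: "(\<lambda>x. f (u x) (v x)) \<in> borel_measurable M"
    if [measurable]: "u \<in> borel_measurable M" "v \<in> borel_measurable M" for u v and M :: "'b measure"
    using measurable_compose[of "\<lambda>x. (u x, v x)" M borel, OF _ assms] by simp
  have "(\<integral>\<^sup>+z. f (fst z) (snd z) * indicator std_triangle z \<partial>lborel)
      = (\<integral>\<^sup>+x. \<integral>\<^sup>+y. f x y * indicator std_triangle (x, y) \<partial>lborel \<partial>lborel)"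
    unfolding lborel_prod[symmetric]
    by (subst lborel.nn_integral_fst[symmetric]) (auto simp: lborel_prod)
  also have "\<dots> = (\<integral>\<^sup>+x. \<integral>\<^sup>+s. f x (s - x) * indicator std_triangle (x, s - x) \<partial>lborel \<partial>lborel)"
  proof (rule nn_integral_cong)
    fix x :: real
    have "(\<lambda>y. f x y * indicator std_triangle (x, y)) \<in> borel_measurable borel" by measurable
    from nn_integral_real_affine[OF this, of 1 "- x"]
    show "(\<integral>\<^sup>+y. f x y * indicator std_triangle (x, y) \<partial>lborel)
        = (\<integral>\<^sup>+s. f x (s - x) * indicator std_triangle (x, s - x) \<partial>lborel)"
      by simp
  qed
  also have "\<dots> = (\<integral>\<^sup>+s. \<integral>\<^sup>+x. f x (s - x) * indicator std_triangle (x, s - x) \<partial>lborel \<partial>lborel)"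
    by (rule lborel_pair.Fubini') measurable
  also have "\<dots> = (\<integral>\<^sup>+s. \<integral>\<^sup>+p. ennreal s * f (s * p) (s * (1 - p)) * indicator {0<..<1} s
      * indicator {0<..<1} p \<partial>lborel \<partial>lborel)"
  proof (rule nn_integral_cong_AE)
    have "AE s in lborel. s \<noteq> 0" by (rule AE_lborel_singleton)
    then show "AE s in lborel. (\<integral>\<^sup>+x. f x (s - x) * indicator std_triangle (x, s - x) \<partial>lborel)
        = (\<integral>\<^sup>+p. ennreal s * f (s * p) (s * (1 - p)) * indicator {0<..<1} s * indicator {0<..<1} p \<partial>lborel)"
      using AE_indicator_Icc_Ioo[of 0 1, where 'a = ennreal]
    proof eventually_elim
      case (elim s)
      have "(\<lambda>x. f x (s - x) * indicator std_triangle (x, s - x)) \<in> borel_measurable borel" by measurable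
      from nn_integral_real_affine[OF this, of s 0] elim
      have "(\<integral>\<^sup>+x. f x (s - x) * indicator std_triangle (x, s - x) \<partial>lborel)
          = ennreal \<bar>s\<bar> * (\<integral>\<^sup>+p. f (s * p) (s - s * p) * indicator std_triangle (s * p, s - s * p) \<partial>lborel)"
        by simp
      also have "\<dots> = (\<integral>\<^sup>+p. ennreal \<bar>s\<bar> * (f (s * p) (s - s * p) * indicator std_triangle (s * p, s - s * p)) \<partial>lborel)"
        by (subst nn_integral_cmult) auto
      also have "\<dots> = (\<integral>\<^sup>+p. ennreal s * f (s * p) (s * (1 - p)) * indicator {0<..<1} s * indicator {0<..<1} p \<partial>lborel)"
      proof (rule nn_integral_cong_AE)
        show "AE p in lborel. ennreal \<bar>s\<bar> * (f (s * p) (s - s * p) * indicator std_triangle (s * p, s - s * p))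
            = ennreal s * f (s * p) (s * (1 - p)) * indicator {0<..<1} s * indicator {0<..<1} p"
          using AE_indicator_Icc_Ioo[of 0 1, where 'a = ennreal]
        proof eventually_elim
          fix p :: real
          assume p: "indicator {0..1} p = (indicator {0<..<1} p :: ennreal)"
          have "indicator std_triangle (s * p, s - s * p) = (indicator {0..1} s * indicator {0..1} p :: ennreal)"
          proof (cases "s > 0")
            case True
            have "(0 \<le> s - s * p) = (p \<le> 1)" using True
              by (metis diff_ge_0_iff_ge mult_le_cancel_left_pos mult.right_neutral)
            then show ?thesis
              using True by (auto simp: std_triangle_def indicator_def zero_le_mult_iff)
          next
            case False
            with elim have "s < 0" by auto
            then have "\<not> (0 \<le> s * p \<and> 0 \<le> s - s * p)"
              by (metis add.commute add_mono diff_add_cancel add.right_neutral not_le)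
            then show ?thesis
              using \<open>s < 0\<close> by (auto simp: std_triangle_def indicator_def)
          qed
          also have "\<dots> = indicator {0<..<1} s * indicator {0<..<1} p"
            using p elim by simp
          finally show "ennreal \<bar>s\<bar> * (f (s * p) (s - s * p) * indicator std_triangle (s * p, s - s * p))
            = ennreal s * f (s * p) (s * (1 - p)) * indicator {0<..<1} s * indicator {0<..<1} p"
            by (auto simp: indicator_def algebra_simps)
        qed
      qed
      finally show ?case .
    qed
  qed
  also have "\<dots> = (\<integral>\<^sup>+p. \<integral>\<^sup>+s. ennreal s * f (s * p) (s * (1 - p)) * indicator {0<..<1} s
      * indicator {0<..<1} p \<partial>lborel \<partial>lborel)"
    by (rule lborel_pair.Fubini') measurable
  also have "\<dots> = (\<integral>\<^sup>+p. (\<integral>\<^sup>+s. ennreal s * f (s * p) (s * (1 - p)) * indicator {0<..<1} s \<partial>lborel)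
          * indicator {0<..<1} p \<partial>lborel)"
    by (intro nn_integral_cong nn_integral_multc) measurable
  finally show ?thesis .
qed

lemma nn_integral_radial_part:
  fixes D :: real
  assumes "0 < D" "D < 1"
  shows "(\<integral>\<^sup>+s. ennreal (s / (1 - s\<^sup>2 * D)) * indicator {0<..<1} s \<partial>lborel) = ennreal (- ln (1 - D) / (2 * D))"
proof -
  have pos: "1 - s\<^sup>2 * D > 0" if "s \<in> {0..1}" for s
  proof -
    have "s\<^sup>2 * D \<le> D" using that assms by (intro mult_left_le_one_le) (auto simp: power_le_one)
    then show ?thesis using assms by linarith
  qed
  have "(\<integral>\<^sup>+s. ennreal (s / (1 - s\<^sup>2 * D)) * indicator {0<..<1} s \<partial>lborel)
      = ennreal (- ln (1 - 1\<^sup>2 * D) / (2 * D) - - ln (1 - 0\<^sup>2 * D) / (2 * D))"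
  proof (rule nn_integral_FTC_interior)
    show "continuous_on {0..1} (\<lambda>s. - ln (1 - s\<^sup>2 * D) / (2 * D))"
      using pos assms by (intro continuous_intros) (auto simp: less_imp_neq[symmetric])
    fix s :: real assume s: "s \<in> {0<..<1}"
    then have "1 - s\<^sup>2 * D > 0" using pos[of s] by simp
    then show "((\<lambda>s. - ln (1 - s\<^sup>2 * D) / (2 * D)) has_real_derivative s / (1 - s\<^sup>2 * D)) (at s)"
      using assms by (auto intro!: derivative_eq_intros simp: divide_simps)
    show "0 \<le> s / (1 - s\<^sup>2 * D)" using \<open>1 - s\<^sup>2 * D > 0\<close> s by simp
  qed simp
  then show ?thesis by simp
qed

text \<open>
  The integrand is symmetric under \<open>p \<mapsto> 1 - p\<close>, so it suffices to integrate up to \<open>1/2\<close>. There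
  \<open>p = w / (1 + w)\<close>, so that \<open>w\<close> is the quotient \<open>x / y\<close> along the ray, brings the integrand into the form \<open>- ln (2 w / (1 + w)\<^sup>2) / (1 + w\<^sup>2)\<close>.
\<close>

lemma nn_integral_angular_part:
  "(\<integral>\<^sup>+p. ennreal (- ln (2 * p * (1 - p)) / (2 * (p\<^sup>2 + (1 - p)\<^sup>2))) * indicator {0<..<1} p \<partial>lborel)
    = ennreal catalan_const"
proof -
  define \<phi> :: "real \<Rightarrow> real" where "\<phi> = (\<lambda>p. - ln (2 * p * (1 - p)) / (2 * (p\<^sup>2 + (1 - p)\<^sup>2)))"
  have [measurable]: "\<phi> \<in> borel_measurable borel" unfolding \<phi>_def by measurable
  have nn: "0 \<le> \<phi> p" if "p \<in> {0..1}" for p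
  proof -
    have "2 * p * (1 - p) \<le> 1" using zero_le_power2[of "2 * p - 1"] by (simp add: power2_eq_square algebra_simps)
    then have "ln (2 * p * (1 - p)) \<le> 0"
      using that by (cases "p = 0 \<or> p = 1") (auto simp: ln_le_zero_iff)
    then show ?thesis
      unfolding \<phi>_def by (intro divide_nonneg_nonneg) auto
  qed
  have sym: "\<phi> (1 - p) = \<phi> p" for p unfolding \<phi>_def by (simp add: mult_ac add_ac)
  let ?h = "\<integral>\<^sup>+p. ennreal (\<phi> p) * indicator {0..1/2} p \<partial>lborel"
  have upper: "(\<integral>\<^sup>+p. ennreal (\<phi> p) * indicator {1/2..1} p \<partial>lborel) = ?h"
  proof -
    have "(\<integral>\<^sup>+p. ennreal (\<phi> p) * indicator {1/2..1} p \<partial>lborel)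
       = (\<integral>\<^sup>+p. ennreal (\<phi> (1 - p)) * indicator {1/2..1} (1 - p) \<partial>lborel)"
      using nn_integral_real_affine[of "\<lambda>p. ennreal (\<phi> p) * indicator {1/2..1} p" "-1" 1] by simp
    also have "\<dots> = ?h" by (intro nn_integral_cong) (auto simp: sym indicator_def)
    finally show ?thesis .
  qed
  have "(\<integral>\<^sup>+p. ennreal (\<phi> p) * indicator {0<..<1} p \<partial>lborel)
     = (\<integral>\<^sup>+p. ennreal (\<phi> p) * indicator {0..1/2} p + ennreal (\<phi> p) * indicator {1/2..1} p \<partial>lborel)"
  proof (rule nn_integral_cong_AE)
    have "AE p in lborel. p \<noteq> (1/2::real)" by (rule AE_lborel_singleton)
    moreover have "AE p in lborel. p \<noteq> (0::real)" by (rule AE_lborel_singleton)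
    moreover have "AE p in lborel. p \<noteq> (1::real)" by (rule AE_lborel_singleton)
    ultimately show "AE p in lborel. ennreal (\<phi> p) * indicator {0<..<1} p
        = ennreal (\<phi> p) * indicator {0..1/2} p + ennreal (\<phi> p) * indicator {1/2..1} p"
      by eventually_elim (auto simp: indicator_def)
  qed
  also have "\<dots> = ?h + ?h"
    by (subst nn_integral_add) (auto simp: upper)
  also have "\<dots> = 2 * ?h" by (simp add: mult_2)
  also have "\<dots> = (\<integral>\<^sup>+p. ennreal ((2 * \<phi> p) * indicator {0 / (1 + 0)..1 / (1 + 1)} p) \<partial>lborel)"
    using nn by (subst nn_integral_cmult[symmetric])
      (auto intro!: nn_integral_cong simp: indicator_def ennreal_mult')
  also have "\<dots> = (\<integral>\<^sup>+w. ennreal ((2 * \<phi> (w / (1 + w))) * (1 / (1 + w)\<^sup>2) * indicator {0..1} w) \<partial>lborel)"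
  proof (rule nn_integral_substitution[where g = "\<lambda>w. w / (1 + w)" and g' = "\<lambda>w. 1 / (1 + w)\<^sup>2"])
    show "set_borel_measurable borel {0 / (1 + 0)..1 / (1 + 1)} (\<lambda>p. 2 * \<phi> p)"
      unfolding set_borel_measurable_def by measurable
    show "((\<lambda>w. w / (1 + w)) has_real_derivative 1 / (1 + w)\<^sup>2) (at w)" if "w \<in> {0..1}" for w :: real
      using that by (auto intro!: derivative_eq_intros simp: power2_eq_square divide_simps)
  qed (auto intro!: continuous_intros)
  also have "\<dots> = (\<integral>\<^sup>+w. ennreal (- ln (2 * w / (1 + w)\<^sup>2) / (1 + w\<^sup>2)) * indicator {0<..<1} w \<partial>lborel)"
  proof (rule nn_integral_cong_AE)
    show "AE w in lborel. ennreal (2 * \<phi> (w / (1 + w)) * (1 / (1 + w)\<^sup>2) * indicator {0..1} w) =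
        ennreal (- ln (2 * w / (1 + w)\<^sup>2) / (1 + w\<^sup>2)) * indicator {0<..<1} w"
      using AE_indicator_Icc_Ioo[of 0 1, where 'a = real]
    proof eventually_elim
      case (elim w)
      show ?case
      proof (cases "w \<in> {0<..<1}")
        case True
        then have w: "1 + w > 0" by simp
        have nz: "1 + w\<^sup>2 \<noteq> 0" using zero_le_power2[of w] by linarith
        have a: "1 - w / (1 + w) = 1 / (1 + w)" using w by (simp add: field_simps)
        have b: "2 * (w / (1 + w)) * (1 / (1 + w)) = 2 * w / (1 + w)\<^sup>2" by (simp add: power2_eq_square)
        have c: "(w / (1 + w))\<^sup>2 + (1 / (1 + w))\<^sup>2 = (1 + w\<^sup>2) / (1 + w)\<^sup>2"
          by (simp add: power_divide add_divide_distrib)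
        have "2 * \<phi> (w / (1 + w)) * (1 / (1 + w)\<^sup>2) = - ln (2 * w / (1 + w)\<^sup>2) / (1 + w\<^sup>2)"
          unfolding \<phi>_def a b c using w nz by (simp add: divide_simps)
        then show ?thesis using True by simp
      qed (use elim in simp)
    qed
  qed
  also have "\<dots> = ennreal catalan_const" by (rule nn_integral_catalan_on_unit_interval)
  finally show ?thesis unfolding \<phi>_def .
qed

text \<open>
  In the coordinates \<open>s\<close>, \<open>p\<close> the denominator is \<open>1 - s\<^sup>2 D\<close> with \<open>D = p\<^sup>2 + (1 - p)\<^sup>2\<close>, and
  \<open>1 - D = 2 p (1 - p)\<close>.
\<close>

lemma nn_integral_std_triangle_catalan:
  "(\<integral>\<^sup>+z. ennreal (1 / (1 - (fst z)\<^sup>2 - (snd z)\<^sup>2)) * indicator std_triangle z \<partial>lborel) = ennreal catalan_const"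
proof -
  have "(\<integral>\<^sup>+z. ennreal (1 / (1 - (fst z)\<^sup>2 - (snd z)\<^sup>2)) * indicator std_triangle z \<partial>lborel)
    = (\<integral>\<^sup>+p. (\<integral>\<^sup>+s. ennreal s * ennreal (1 / (1 - (s * p)\<^sup>2 - (s * (1 - p))\<^sup>2)) * indicator {0<..<1} s \<partial>lborel)
          * indicator {0<..<1} p \<partial>lborel)"
    by (rule nn_integral_std_triangle_scaling[where f = "\<lambda>x y. ennreal (1 / (1 - x\<^sup>2 - y\<^sup>2))"])
       (unfold borel_prod[symmetric], measurable)
  also have "\<dots> = (\<integral>\<^sup>+p. ennreal (- ln (2 * p * (1 - p)) / (2 * (p\<^sup>2 + (1 - p)\<^sup>2))) * indicator {0<..<1} p \<partial>lborel)"
  proof (rule nn_integral_cong)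
    fix p :: real
    show "(\<integral>\<^sup>+s. ennreal s * ennreal (1 / (1 - (s * p)\<^sup>2 - (s * (1 - p))\<^sup>2)) * indicator {0<..<1} s \<partial>lborel)
          * indicator {0<..<1} p
        = ennreal (- ln (2 * p * (1 - p)) / (2 * (p\<^sup>2 + (1 - p)\<^sup>2))) * indicator {0<..<1} p"
    proof (cases "p \<in> {0<..<1}")
      case True
      define D where "D = p\<^sup>2 + (1 - p)\<^sup>2"
      have D1: "1 - D = 2 * p * (1 - p)" by (simp add: D_def power2_eq_square algebra_simps)
      have "0 < 2 * p * (1 - p)" using True by simp
      then have "D < 1" using D1 by linarith
      moreover have "0 < D" using True by (auto simp: D_def intro!: add_pos_nonneg)
      ultimately have D: "0 < D" "D < 1" by auto
      have "(\<integral>\<^sup>+s. ennreal s * ennreal (1 / (1 - (s * p)\<^sup>2 - (s * (1 - p))\<^sup>2)) * indicator {0<..<1} s \<partial>lborel)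
          = (\<integral>\<^sup>+s. ennreal (s / (1 - s\<^sup>2 * D)) * indicator {0<..<1} s \<partial>lborel)"
      proof (rule nn_integral_cong)
        fix s :: real
        have eq: "1 - (s * p)\<^sup>2 - (s * (1 - p))\<^sup>2 = 1 - s\<^sup>2 * D"
          unfolding D_def by (simp add: power2_eq_square algebra_simps)
        show "ennreal s * ennreal (1 / (1 - (s * p)\<^sup>2 - (s * (1 - p))\<^sup>2)) * indicator {0<..<1} s
            = ennreal (s / (1 - s\<^sup>2 * D)) * indicator {0<..<1} s"
          unfolding eq by (auto simp: indicator_def ennreal_mult'[symmetric])
      qed
      also have "\<dots> = ennreal (- ln (1 - D) / (2 * D))"
        using D by (rule nn_integral_radial_part)
      finally show ?thesis unfolding D1 unfolding D_def by simp
    qed simp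
  qed
  also have "\<dots> = ennreal catalan_const"
    by (rule nn_integral_angular_part)
  finally show ?thesis .
qed

section \<open>The monomial integrals and their convergence\<close>

text \<open>
  This is \<open>(x + y)\<^sup>2 \<le> 1\<close>. Equality holds on the hypotenuse, where the denominator is \<open>2 x y\<close>: the
  powers of \<open>x\<close> and \<open>y\<close> in the numerator cancel it there, and this is what keeps all boundary terms rational.
\<close>

lemma two_xy_le:
  assumes "(x, y) \<in> std_triangle"
  shows "2 * x * y \<le> 1 - x\<^sup>2 - y\<^sup>2"
proof -
  have "(x + y)\<^sup>2 \<le> 1\<^sup>2"
    using assms by (intro power_mono) (auto simp: std_triangle_def)
  then show ?thesis by (simp add: power2_eq_square algebra_simps)
qed

lemma denominator_nonneg:
  assumes "(x, y) \<in> std_triangle"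
  shows "0 \<le> 1 - x\<^sup>2 - y\<^sup>2"
proof -
  have "0 \<le> 2 * x * y" using assms by (simp add: std_triangle_def)
  then show ?thesis using two_xy_le[OF assms] by linarith
qed

definition integrand :: "nat \<Rightarrow> nat \<Rightarrow> nat \<Rightarrow> real \<times> real \<Rightarrow> real" where
  "integrand a b t = (\<lambda>(x, y). x ^ a * y ^ b / (1 - x\<^sup>2 - y\<^sup>2) ^ (t + 1))"

definition period :: "nat \<Rightarrow> nat \<Rightarrow> nat \<Rightarrow> real" where
  "period a b t = (LINT z:std_triangle|lborel. integrand a b t z)"

lemma measurable_integrand [measurable]: "integrand a b t \<in> borel_measurable borel"
  unfolding integrand_def borel_prod[symmetric] by measurable

lemma integrand_0: "integrand 0 0 0 = (\<lambda>z. 1 / (1 - (fst z)\<^sup>2 - (snd z)\<^sup>2))"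
  by (rule ext) (simp add: integrand_def case_prod_beta)

text \<open>
  The integrand is nonnegative, so the value of its nonnegative integral gives convergence as well.
\<close>

lemma
  shows set_integrable_integrand_0: "set_integrable lborel std_triangle (integrand 0 0 0)"
    and period_0: "period 0 0 0 = catalan_const"
proof -
  have nn: "0 \<le> indicator std_triangle z *\<^sub>R integrand 0 0 0 z" for z
    using denominator_nonneg[of "fst z" "snd z"] by (auto simp: integrand_0 indicator_def)
  have "(\<integral>\<^sup>+z. ennreal (indicator std_triangle z *\<^sub>R integrand 0 0 0 z) \<partial>lborel) = ennreal catalan_const"
    unfolding nn_integral_std_triangle_catalan[symmetric]
    by (intro nn_integral_cong) (auto simp: integrand_0 indicator_def)
  then have "has_bochner_integral lborel (\<lambda>z. indicator std_triangle z *\<^sub>R integrand 0 0 0 z) catalan_const"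
    using nn catalan_const_nonneg by (intro has_bochner_integral_nn_integral) auto
  then show "set_integrable lborel std_triangle (integrand 0 0 0)" "period 0 0 0 = catalan_const"
    by (auto simp: set_integrable_def period_def set_lebesgue_integral_def has_bochner_integral_iff)
qed

text \<open>
  With \<open>Q = 1 - x\<^sup>2 - y\<^sup>2\<close> one has \<open>x ^ a * y ^ b \<le> (x * y) ^ t \<le> Q ^ t\<close>, hence the integrand
  is at most \<open>1 / Q\<close>; where \<open>Q = 0\<close>, both are \<open>0\<close> by convention.
\<close>

lemma set_integrable_integrand:
  assumes "t \<le> a" "t \<le> b"
  shows "set_integrable lborel std_triangle (integrand a b t)"
proof -
  have bound: "norm (integrand a b t z) \<le> norm (integrand 0 0 0 z)" if "z \<in> std_triangle" for z
  proof -
    obtain x y where z: "z = (x, y)" by (cases z)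
    have xy: "0 \<le> x" "x \<le> 1" "0 \<le> y" "y \<le> 1"
      using that by (auto simp: z std_triangle_def)
    define Q where "Q = 1 - x\<^sup>2 - y\<^sup>2"
    have Q: "0 \<le> Q" unfolding Q_def using that z by (intro denominator_nonneg) simp
    have "x ^ a * y ^ b \<le> x ^ t * y ^ t"
      using xy assms by (intro mult_mono power_decreasing) auto
    also have "\<dots> = (x * y) ^ t" by (simp add: power_mult_distrib)
    also have "\<dots> \<le> Q ^ t"
    proof (rule power_mono)
      have "0 \<le> x * y" using xy by simp
      then show "x * y \<le> Q" using two_xy_le[of x y] that unfolding Q_def z by linarith
    qed (use xy in simp)
    finally have le: "x ^ a * y ^ b \<le> Q ^ t" .
    have "x ^ a * y ^ b / Q ^ (t + 1) \<le> Q ^ t / Q ^ (t + 1)"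
      using le Q by (intro divide_right_mono) auto
    also have "\<dots> \<le> 1 / Q"
      using Q by (cases "Q = 0") auto
    finally have "x ^ a * y ^ b / Q ^ (t + 1) \<le> 1 / Q" .
    then show ?thesis
      using xy Q unfolding z integrand_def prod.case Q_def[symmetric] by simp
  qed
  have m: "set_borel_measurable lborel std_triangle (integrand a b t)"
    unfolding set_borel_measurable_def by measurable
  show ?thesis
    by (rule set_integrable_bound[OF set_integrable_integrand_0 m]) (use bound in auto)
qed

lemma integral_std_triangle_swap:
  fixes f :: "real \<times> real \<Rightarrow> real"
  assumes [measurable]: "f \<in> borel_measurable borel"
  shows "(LINT (x, y):std_triangle|lborel. f (y, x)) = (LINT z:std_triangle|lborel. f z)"
proof -
  have "(\<lambda>z. indicator std_triangle z *\<^sub>R f z) \<in> borel_measurable (lborel \<Otimes>\<^sub>M lborel)"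
    unfolding lborel_prod by measurable
  from lborel_pair.integral_product_swap[OF this] show ?thesis
    unfolding set_lebesgue_integral_def lborel_prod
    by (simp add: case_prod_unfold indicator_def std_triangle_def algebra_simps conj_commute conj_left_commute)
qed

lemma period_swap: "period a b t = period b a t"
proof -
  have "period a b t = (LINT (x, y):std_triangle|lborel. integrand a b t (y, x))"
    unfolding period_def by (rule integral_std_triangle_swap[symmetric]) measurable
  also have "(\<lambda>(x, y). integrand a b t (y, x)) = integrand b a t"
    by (auto simp: integrand_def algebra_simps)
  finally show ?thesis unfolding period_def .
qed

section \<open>Linear relations between the monomial integrals\<close>

text \<open>
  Green's formula for a form \<open>H dy\<close>. Differentiability is needed on the horizontal slices with
  \<open>0 < y < 1\<close> only; these avoid the two vertices where the denominator vanishes.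
\<close>

lemma integral_std_triangle_FTC:
  fixes g H :: "real \<Rightarrow> real \<Rightarrow> real"
  assumes int: "set_integrable lborel std_triangle (\<lambda>(x, y). g x y)"
    and deriv: "\<And>x y. 0 < y \<Longrightarrow> y < 1 \<Longrightarrow> 0 \<le> x \<Longrightarrow> x \<le> 1 - y \<Longrightarrow>
      ((\<lambda>x. H x y) has_real_derivative g x y) (at x)"
    and bdry: "\<And>y. 0 < y \<Longrightarrow> y < 1 \<Longrightarrow> H (1 - y) y - H 0 y = B y"
    and [measurable]: "B \<in> borel_measurable borel"
  shows "(LINT (x, y):std_triangle|lborel. g x y) = (LINT y:{0..1}|lborel. B y)"
proof -
  have slice: "(\<lambda>x. indicator std_triangle (x, y) *\<^sub>R g x y) = (\<lambda>x. indicator {0..1 - y} x *\<^sub>R g x y)"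
    if "0 < y" for y
    using that by (intro ext) (auto simp: indicator_def std_triangle_def)
  let ?f = "\<lambda>z. indicator std_triangle z *\<^sub>R (case z of (x, y) \<Rightarrow> g x y)"
  have int': "integrable (lborel \<Otimes>\<^sub>M lborel) (case_prod (\<lambda>x y. ?f (x, y)))"
    using int unfolding set_integrable_def lborel_prod by (simp add: case_prod_unfold)
  have "(LINT (x, y):std_triangle|lborel. g x y) = integral\<^sup>L (lborel \<Otimes>\<^sub>M lborel) (case_prod (\<lambda>x y. ?f (x, y)))"
    unfolding set_lebesgue_integral_def lborel_prod by (simp add: case_prod_unfold)
  also have "\<dots> = (LINT y|lborel. LINT x|lborel. ?f (x, y))"
    by (rule lborel_pair.integral_snd[symmetric]) (rule int')
  also have "\<dots> = (LINT y:{0..1}|lborel. B y)"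
    unfolding set_lebesgue_integral_def
  proof (rule integral_cong_AE)
    show "(\<lambda>y. LINT x|lborel. ?f (x, y)) \<in> borel_measurable lborel"
      using lborel_pair.integrable_snd[OF int'] by (auto intro: borel_measurable_integrable)
    have "AE y in lborel. y \<noteq> (0::real)" by (rule AE_lborel_singleton)
    moreover have "AE y in lborel. y \<noteq> (1::real)" by (rule AE_lborel_singleton)
    moreover have "AE y in lborel. integrable lborel (\<lambda>x. ?f (x, y))"
      using lborel_pair.AE_integrable_snd[OF int'] by simp
    ultimately show "AE y in lborel. (LINT x|lborel. ?f (x, y)) = indicator {0..1} y *\<^sub>R B y"
    proof eventually_elim
      case (elim y)
      show ?case
      proof (cases "y \<in> {0<..<1}")
        case True
        then have y: "0 < y" "y < 1" by auto
        have si: "integrable lborel (\<lambda>x. indicator {0..1 - y} x *\<^sub>R g x y)"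
          using elim slice[OF y(1)] by simp
        have "((\<lambda>x. g x y) has_integral (H (1 - y) y - H 0 y)) {0..1 - y}"
          using y deriv by (intro fundamental_theorem_of_calculus)
            (auto simp: has_real_derivative_iff_has_vector_derivative[symmetric] intro: DERIV_subset)
        moreover have "((\<lambda>x. g x y) has_integral (LINT x:{0..1 - y}|lborel. g x y)) {0..1 - y}"
          using si set_borel_integral_eq_integral[of "{0..1 - y}" "\<lambda>x. g x y"]
          by (simp add: set_integrable_def has_integral_iff)
        ultimately have "(LINT x:{0..1 - y}|lborel. g x y) = B y"
          using bdry[OF y] by (metis has_integral_unique)
        then show ?thesis
          using True slice[OF y(1)] by (simp add: set_lebesgue_integral_def)
      next
        case False
        with elim have "y < 0 \<or> y > 1" by auto
        then have "indicator std_triangle (x, y) = (0 :: real)" "indicator {0..1} y = (0 :: real)" for x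
          by (auto simp: std_triangle_def indicator_def)
        then show ?thesis by simp
      qed
    qed
    show "(\<lambda>y. indicator {0..1} y *\<^sub>R B y) \<in> borel_measurable lborel"
      by measurable
  qed
  finally show ?thesis .
qed

lemma integral_power_mult_power_Rats: "(LINT y:{0..1}|lborel. (1 - y) ^ i * y ^ j :: real) \<in> \<rat>"
proof (induction i arbitrary: j)
  case 0
  have "(LINT y:{0..1}|lborel. y ^ j :: real) = 1 / real (Suc j)"
    using integral_power[of 0 1 j] by (simp add: set_lebesgue_integral_def mult.commute)
  then show ?case by simp
next
  case (Suc i)
  have int: "set_integrable lborel {0..1} (\<lambda>y. (1 - y) ^ i * y ^ k :: real)" for k
    unfolding set_integrable_def
    by (rule borel_integrable_compact) (auto intro!: continuous_intros)
  have "(LINT y:{0..1}|lborel. (1 - y) ^ Suc i * y ^ j :: real)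
      = (LINT y:{0..1}|lborel. (1 - y) ^ i * y ^ j - (1 - y) ^ i * y ^ Suc j)"
    by (simp add: algebra_simps)
  also have "\<dots> = (LINT y:{0..1}|lborel. (1 - y) ^ i * y ^ j) - (LINT y:{0..1}|lborel. (1 - y) ^ i * y ^ Suc j)"
    by (rule set_integral_diff(2)[OF int int])
  also have "\<dots> \<in> \<rat>" using Suc.IH by (intro Rats_diff)
  finally show ?case .
qed

lemma denominator_pos:
  fixes x y :: real
  assumes "0 < y" "y < 1" "0 \<le> x" "x \<le> 1 - y"
  shows "0 < 1 - x\<^sup>2 - y\<^sup>2"
proof -
  have "x\<^sup>2 \<le> (1 - y)\<^sup>2" using assms by (intro power_mono) auto
  moreover have "0 < y * (1 - y)" using assms by simp
  ultimately show ?thesis by (simp add: power2_eq_square algebra_simps)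
qed

text \<open>
  The antiderivative in \<open>x\<close> is \<open>x ^ (a + 1) * y ^ b / Q ^ (t + 1)\<close>. It vanishes on the side \<open>x = 0\<close>, and on
  the hypotenuse \<open>Q = 2 x y\<close> cancels, which leaves a polynomial with rational coefficients.
\<close>

lemma period_stokes:
  assumes "t \<le> a" "t + 1 \<le> b"
  shows "real (a + 1) * period a b t + 2 * real (t + 1) * period (a + 2) b (t + 1) \<in> \<rat>"
proof -
  define Q :: "real \<Rightarrow> real \<Rightarrow> real" where "Q = (\<lambda>x y. 1 - x\<^sup>2 - y\<^sup>2)"
  define g where "g = (\<lambda>x y. real (a + 1) * integrand a b t (x, y) + 2 * real (t + 1) * integrand (a + 2) b (t + 1) (x, y))"
  have i1: "set_integrable lborel std_triangle (\<lambda>z. real (a + 1) * integrand a b t z)"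
    using assms by (intro set_integrable_mult_right set_integrable_integrand) auto
  have i2: "set_integrable lborel std_triangle (\<lambda>z. 2 * real (t + 1) * integrand (a + 2) b (t + 1) z)"
    using assms by (intro set_integrable_mult_right set_integrable_integrand) auto
  have g: "(\<lambda>(x, y). g x y) = (\<lambda>z. real (a + 1) * integrand a b t z + 2 * real (t + 1) * integrand (a + 2) b (t + 1) z)"
    by (auto simp: g_def)
  have "real (a + 1) * period a b t + 2 * real (t + 1) * period (a + 2) b (t + 1) = (LINT (x, y):std_triangle|lborel. g x y)"
    unfolding g set_integral_add(2)[OF i1 i2] by (simp add: period_def)
  also have "\<dots> = (LINT y:{0..1}|lborel. (1 / 2 ^ (t + 1)) * ((1 - y) ^ (a - t) * y ^ (b - (t + 1))))"
  proof (rule integral_std_triangle_FTC)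
    show "set_integrable lborel std_triangle (\<lambda>(x, y). g x y)"
      unfolding g by (rule set_integral_add(1)[OF i1 i2])
    show "((\<lambda>x. x ^ (a + 1) * y ^ b / Q x y ^ (t + 1)) has_real_derivative g x y) (at x)"
      if "0 < y" "y < 1" "0 \<le> x" "x \<le> 1 - y" for x y
    proof -
      have pos: "Q x y > 0" using denominator_pos[OF that] by (simp add: Q_def)
      have Q': "((\<lambda>x. Q x y) has_real_derivative - 2 * x) (at x)"
        unfolding Q_def by (auto intro!: derivative_eq_intros)
      have num: "((\<lambda>x. x ^ (a + 1) * y ^ b) has_real_derivative real (a + 1) * x ^ a * y ^ b) (at x)"
        using DERIV_cmult_right[OF DERIV_pow[of "a + 1" x], of "y ^ b"] by simp
      have den: "((\<lambda>x. Q x y ^ (t + 1)) has_real_derivative real (t + 1) * ((- 2 * x) * Q x y ^ t)) (at x)"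
        using DERIV_power[OF Q', of "t + 1"] by simp
      have "((\<lambda>x. x ^ (a + 1) * y ^ b / Q x y ^ (t + 1)) has_real_derivative
          (real (a + 1) * x ^ a * y ^ b * Q x y ^ (t + 1) - x ^ (a + 1) * y ^ b * (real (t + 1) * ((- 2 * x) * Q x y ^ t)))
            / (Q x y ^ (t + 1) * Q x y ^ (t + 1))) (at x)"
        using pos by (intro DERIV_divide num den) auto
      also have "real (a + 1) * x ^ a * y ^ b * Q x y ^ (t + 1) - x ^ (a + 1) * y ^ b * (real (t + 1) * ((- 2 * x) * Q x y ^ t))
          = Q x y ^ t * (real (a + 1) * (x ^ a * y ^ b) * Q x y + 2 * real (t + 1) * (x ^ (a + 2) * y ^ b))"
        by (simp add: algebra_simps)
      also have "Q x y ^ (t + 1) * Q x y ^ (t + 1) = Q x y ^ t * Q x y ^ (t + 2)"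
        by (simp add: algebra_simps)
      also have "Q x y ^ t * (real (a + 1) * (x ^ a * y ^ b) * Q x y + 2 * real (t + 1) * (x ^ (a + 2) * y ^ b))
          / (Q x y ^ t * Q x y ^ (t + 2))
          = real (a + 1) * (x ^ a * y ^ b) * Q x y / Q x y ^ (t + 2) + 2 * real (t + 1) * (x ^ (a + 2) * y ^ b) / Q x y ^ (t + 2)"
        using pos by (subst add_divide_distrib[symmetric]) simp
      also have "real (a + 1) * (x ^ a * y ^ b) * Q x y / Q x y ^ (t + 2) = real (a + 1) * (x ^ a * y ^ b) / Q x y ^ (t + 1)"
        using pos by simp
      also have "real (a + 1) * (x ^ a * y ^ b) / Q x y ^ (t + 1) + 2 * real (t + 1) * (x ^ (a + 2) * y ^ b) / Q x y ^ (t + 2) = g x y"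
        by (simp add: g_def integrand_def Q_def)
      finally show ?thesis .
    qed
    show "(1 - y) ^ (a + 1) * y ^ b / Q (1 - y) y ^ (t + 1) - 0 ^ (a + 1) * y ^ b / Q 0 y ^ (t + 1)
        = 1 / 2 ^ (t + 1) * ((1 - y) ^ (a - t) * y ^ (b - (t + 1)))" if "0 < y" "y < 1" for y
    proof -
      have Q: "Q (1 - y) y = 2 * (1 - y) * y" by (simp add: Q_def power2_eq_square algebra_simps)
      have cancel: "A * U * (B * Y) / (c * (U * Y)) - 0 = 1 / c * (A * B)" if "U \<noteq> 0" "Y \<noteq> 0"
        for A B U Y c :: real using that by simp
      have 1: "(1 - y) ^ (a + 1) = (1 - y) ^ (a - t) * (1 - y) ^ (t + 1)"
        by (subst power_add[symmetric]) (use assms in simp)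
      have 2: "y ^ b = y ^ (b - (t + 1)) * y ^ (t + 1)"
        by (subst power_add[symmetric]) (use assms in simp)
      have 3: "Q (1 - y) y ^ (t + 1) = 2 ^ (t + 1) * ((1 - y) ^ (t + 1) * y ^ (t + 1))"
        unfolding Q by (simp only: power_mult_distrib mult.assoc)
      have 4: "0 ^ (a + 1) * y ^ b / Q 0 y ^ (t + 1) = 0"
        by simp
      show ?thesis
        unfolding 4 unfolding 1 2 3 by (rule cancel) (use that in auto)
    qed
  qed measurable
  also have "\<dots> \<in> \<rat>"
    using integral_power_mult_power_Rats by simp
  finally show ?thesis .
qed

text \<open>
  Multiply numerator and denominator by \<open>1 - x\<^sup>2 - y\<^sup>2\<close>. The identity of integrands also holds at the vertices
  with zero denominator, where every quotient is \<open>0\<close> by convention.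
\<close>

lemma period_raise_level:
  assumes "t + 1 \<le> a" "t + 1 \<le> b"
  shows "period a b t = period a b (t + 1) - period (a + 2) b (t + 1) - period a (b + 2) (t + 1)"
proof -
  have "integrand a b t = (\<lambda>z. integrand a b (t + 1) z - integrand (a + 2) b (t + 1) z - integrand a (b + 2) (t + 1) z)"
  proof
    fix z :: "real \<times> real"
    obtain x y where z: "z = (x, y)" by (cases z)
    define Q where "Q = 1 - x\<^sup>2 - y\<^sup>2"
    have "x ^ a * y ^ b / Q ^ (t + 1) = x ^ a * y ^ b * Q / Q ^ (t + 2)" by simp
    also have "x ^ a * y ^ b * Q = x ^ a * y ^ b - x ^ (a + 2) * y ^ b - x ^ a * y ^ (b + 2)"
      by (simp add: Q_def power_add power2_eq_square algebra_simps)
    also have "\<dots> / Q ^ (t + 2)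
        = x ^ a * y ^ b / Q ^ (t + 2) - x ^ (a + 2) * y ^ b / Q ^ (t + 2) - x ^ a * y ^ (b + 2) / Q ^ (t + 2)"
      by (simp only: diff_divide_distrib)
    finally show "integrand a b t z = integrand a b (t + 1) z - integrand (a + 2) b (t + 1) z - integrand a (b + 2) (t + 1) z"
      by (simp add: integrand_def z Q_def)
  qed
  moreover have "set_integrable lborel std_triangle (integrand a b (t + 1))"
    "set_integrable lborel std_triangle (integrand (a + 2) b (t + 1))"
    "set_integrable lborel std_triangle (integrand a (b + 2) (t + 1))"
    using assms by (auto intro!: set_integrable_integrand)
  ultimately show ?thesis
    unfolding period_def by (simp add: set_integral_diff)
qed

text \<open>
  The combined integrand is \<open>x ^ a * y ^ b\<close> wherever the denominator is not zero.
\<close>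

lemma period_0_relation: "period a b 0 - period (a + 2) b 0 - period a (b + 2) 0 \<in> \<rat>"
proof -
  define g where "g = (\<lambda>x y. integrand a b 0 (x, y) - integrand (a + 2) b 0 (x, y) - integrand a (b + 2) 0 (x, y))"
  have int: "set_integrable lborel std_triangle (integrand a b 0)"
    "set_integrable lborel std_triangle (integrand (a + 2) b 0)"
    "set_integrable lborel std_triangle (integrand a (b + 2) 0)"
    by (auto intro!: set_integrable_integrand)
  have g: "(\<lambda>(x, y). g x y) = (\<lambda>z. integrand a b 0 z - integrand (a + 2) b 0 z - integrand a (b + 2) 0 z)"
    by (auto simp: g_def)
  have "period a b 0 - period (a + 2) b 0 - period a (b + 2) 0 = (LINT (x, y):std_triangle|lborel. g x y)"
    unfolding g period_def using int by (simp add: set_integral_diff)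
  also have "\<dots> = (LINT y:{0..1}|lborel. (1 / real (a + 1)) * ((1 - y) ^ (a + 1) * y ^ b))"
  proof (rule integral_std_triangle_FTC)
    show "set_integrable lborel std_triangle (\<lambda>(x, y). g x y)"
      unfolding g using int by (intro set_integral_diff(1))
    show "((\<lambda>x. (1 / real (a + 1)) * (x ^ (a + 1) * y ^ b)) has_real_derivative g x y) (at x)"
      if "0 < y" "y < 1" "0 \<le> x" "x \<le> 1 - y" for x y
    proof -
      define Q where "Q = 1 - x\<^sup>2 - y\<^sup>2"
      have Q: "Q > 0" using denominator_pos[OF that] by (simp add: Q_def)
      have "g x y = (x ^ a * y ^ b - x ^ (a + 2) * y ^ b - x ^ a * y ^ (b + 2)) / Q"
        by (simp add: g_def integrand_def Q_def diff_divide_distrib)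
      also have "x ^ a * y ^ b - x ^ (a + 2) * y ^ b - x ^ a * y ^ (b + 2) = x ^ a * y ^ b * Q"
        by (simp add: Q_def power_add power2_eq_square algebra_simps)
      also have "x ^ a * y ^ b * Q / Q = x ^ a * y ^ b" using Q by simp
      finally have g_eq: "g x y = x ^ a * y ^ b" .
      have num: "((\<lambda>x. x ^ (a + 1) * y ^ b) has_real_derivative real (a + 1) * x ^ a * y ^ b) (at x)"
        using DERIV_cmult_right[OF DERIV_pow[of "a + 1" x], of "y ^ b"] by simp
      have "((\<lambda>x. (1 / real (a + 1)) * (x ^ (a + 1) * y ^ b)) has_real_derivative
          (1 / real (a + 1)) * (real (a + 1) * x ^ a * y ^ b)) (at x)"
        by (rule DERIV_cmult[OF num])
      then show ?thesis by (simp add: g_eq)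
    qed
  qed auto
  also have "\<dots> \<in> \<rat>"
    using integral_power_mult_power_Rats[of "a + 1" b] by simp
  finally show ?thesis .
qed

section \<open>Reduction to Catalan's constant\<close>

definition catalan_span :: "real set" where
  "catalan_span = {of_rat p + of_rat q * catalan_const | p q. True}"

lemma catalan_span_Rats: "r \<in> \<rat> \<Longrightarrow> r \<in> catalan_span"
proof -
  assume "r \<in> \<rat>"
  then obtain p where "r = of_rat p + of_rat 0 * catalan_const" by (auto elim: Rats_cases)
  then show ?thesis unfolding catalan_span_def by blast
qed

lemma catalan_span_catalan_const: "catalan_const \<in> catalan_span"
proof -
  have "catalan_const = of_rat 0 + of_rat 1 * catalan_const" by simp
  then show ?thesis unfolding catalan_span_def by blast
qed

lemma catalan_span_add:
  assumes "u \<in> catalan_span" "v \<in> catalan_span"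
  shows "u + v \<in> catalan_span"
proof -
  obtain p q p' q' where "u = of_rat p + of_rat q * catalan_const" "v = of_rat p' + of_rat q' * catalan_const"
    using assms unfolding catalan_span_def by blast
  then have "u + v = of_rat (p + p') + of_rat (q + q') * catalan_const"
    by (simp add: of_rat_add algebra_simps)
  then show ?thesis unfolding catalan_span_def by blast
qed

lemma catalan_span_scale:
  assumes "r \<in> \<rat>" "u \<in> catalan_span"
  shows "r * u \<in> catalan_span"
proof -
  obtain p q s where "u = of_rat p + of_rat q * catalan_const" "r = of_rat s"
    using assms unfolding catalan_span_def by (auto elim: Rats_cases)
  then have "r * u = of_rat (s * p) + of_rat (s * q) * catalan_const"
    by (simp add: of_rat_mult algebra_simps)
  then show ?thesis unfolding catalan_span_def by blast
qed

lemma catalan_span_diff: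
  assumes "u \<in> catalan_span" "v \<in> catalan_span"
  shows "u - v \<in> catalan_span"
  using catalan_span_add[OF assms(1) catalan_span_scale[of "-1" v]] assms by simp

text \<open>
  The form in which relations modulo \<open>\<rat>\<close> are used: a rational relation carries membership from one
  integral to another.
\<close>

lemma catalan_span_solve:
  assumes "r * u + s * v \<in> \<rat>" "v \<in> catalan_span" "r \<in> \<rat>" "s \<in> \<rat>" "r \<noteq> 0"
  shows "u \<in> catalan_span"
proof -
  have "u = (1 / r) * ((r * u + s * v) - s * v)" using assms by (simp add: field_simps)
  also have "\<dots> \<in> catalan_span"
    using assms by (intro catalan_span_scale catalan_span_diff) (auto intro: catalan_span_Rats catalan_span_scale)
  finally show ?thesis .
qed

text \<open>
  The relation \<open>period_stokes\<close> at \<open>t = 0\<close> and its mirror image under \<open>x \<leftrightarrow> y\<close> contain the same integral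
  with exponents \<open>a + 2\<close>, \<open>b + 2\<close>. Eliminating it compares \<open>period a (b + 2) 0\<close> with
  \<open>period (a + 2) b 0\<close>, and \<open>period_0_relation\<close> then expresses the latter by \<open>period a b 0\<close>.
\<close>

lemma period_0_recursion:
  "real (a + b + 2) * period (a + 2) b 0 + (- real (a + 1)) * period a b 0 \<in> \<rat>"
proof -
  let ?w = "period (a + 2) (b + 2) 1"
  have 1: "real (a + 1) * period a (b + 2) 0 + 2 * ?w \<in> \<rat>"
    using period_stokes[of 0 a "b + 2"] by simp
  have 2: "real (b + 1) * period (a + 2) b 0 + 2 * ?w \<in> \<rat>"
    using period_stokes[of 0 b "a + 2"]
    unfolding period_swap[of b "a + 2"] period_swap[of "b + 2" "a + 2"] by simp
  have 3: "real (a + 1) * (period a b 0 - period (a + 2) b 0 - period a (b + 2) 0) \<in> \<rat>"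
    by (intro Rats_mult period_0_relation) auto
  have "(real (b + 1) * period (a + 2) b 0 + 2 * ?w) - (real (a + 1) * period a (b + 2) 0 + 2 * ?w)
      - real (a + 1) * (period a b 0 - period (a + 2) b 0 - period a (b + 2) 0) \<in> \<rat>"
    using 1 2 3 by (intro Rats_diff)
  then show ?thesis by (simp add: algebra_simps)
qed

lemma period_0_in_catalan_span: "period (2 * A) (2 * B) 0 \<in> catalan_span"
proof -
  have step: "period (2 * A) b 0 \<in> catalan_span" if "period 0 b 0 \<in> catalan_span" for A b
  proof (induction A)
    case (Suc A)
    have "period (2 * A + 2) b 0 \<in> catalan_span"
      by (rule catalan_span_solve[OF period_0_recursion Suc.IH]) auto
    then show ?case by simp
  qed (use that in simp)
  have "period 0 (2 * B) 0 \<in> catalan_span"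
    by (subst period_swap, rule step) (simp add: period_0 catalan_span_catalan_const)
  then show ?thesis by (rule step)
qed

text \<open>
  Each use of \<open>period_stokes\<close> lowers \<open>t\<close> by one and an exponent by two. At \<open>t + 1\<close> this keeps both
  exponents at least \<open>t\<close> if one of them is at least \<open>t + 2\<close>. The only remaining case is that both exponents equal
  \<open>t + 1\<close>; \<open>period_raise_level\<close> writes that integral as the sum of one of level \<open>t\<close> and two in which
  one of the exponents is larger.
\<close>

lemma period_in_catalan_span:
  assumes "t \<le> 2 * A" "t \<le> 2 * B"
  shows "period (2 * A) (2 * B) t \<in> catalan_span"
  using assms
proof (induction t arbitrary: A B)
  case 0
  show ?case by (rule period_0_in_catalan_span)
next
  case (Suc t)
  have reduce: "period (2 * A) (2 * B) (Suc t) \<in> catalan_span"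
    if le: "t + 2 \<le> 2 * A" "t + 1 \<le> 2 * B" for A B
  proof (rule catalan_span_solve)
    obtain A' where A: "A = Suc A'" using le by (cases A) auto
    show "2 * real (t + 1) * period (2 * A) (2 * B) (Suc t) + real (2 * A - 1) * period (2 * (A - 1)) (2 * B) t \<in> \<rat>"
      using period_stokes[of t "2 * A'" "2 * B"] le by (simp add: A add_ac)
    show "period (2 * (A - 1)) (2 * B) t \<in> catalan_span"
      using le by (intro Suc.IH) auto
  qed auto
  consider "t + 2 \<le> 2 * A" | "t + 2 \<le> 2 * B" | "2 * A = t + 1" "2 * B = t + 1"
    using Suc.prems by linarith
  then show ?case
  proof cases
    case 1
    then show ?thesis using Suc.prems by (intro reduce) auto
  next
    case 2
    then show ?thesis
      by (subst period_swap, intro reduce) (use Suc.prems in auto)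
  next
    case 3
    have "period (2 * A) (2 * B) (Suc t)
      = period (2 * A) (2 * B) t + period (2 * Suc A) (2 * B) (Suc t) + period (2 * A) (2 * Suc B) (Suc t)"
      using period_raise_level[of t "2 * A" "2 * B"] 3 by simp
    moreover have "period (2 * A) (2 * B) t \<in> catalan_span"
      using 3 by (intro Suc.IH) auto
    moreover have "period (2 * Suc A) (2 * B) (Suc t) \<in> catalan_span"
      using 3 by (intro reduce) auto
    moreover have "period (2 * A) (2 * Suc B) (Suc t) \<in> catalan_span"
      by (subst period_swap, rule reduce) (use 3 in auto)
    ultimately show ?thesis by (simp add: catalan_span_add)
  qed
qed

section \<open>Averaging over the orbit of the rotation\<close>

lemma rat_poly2_monomial_induct [case_names zero add monomial]:
  fixes F :: "rat poly poly"
  assumes zero: "P 0"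
    and add: "\<And>F G. P F \<Longrightarrow> P G \<Longrightarrow> P (F + G)"
    and monomial: "\<And>c i j. P (const2 c * var_x ^ i * var_y ^ j)"
  shows "P F"
proof -
  have inner: "P ([:c:] * var_x ^ i * var_y ^ j)" for c i j
  proof (induction c arbitrary: i)
    case 0
    show ?case using zero by simp
  next
    case (pCons q c)
    have split: "[:pCons q c:] * var_x ^ i * var_y ^ j
        = const2 q * var_x ^ i * var_y ^ j + [:c:] * var_x ^ Suc i * var_y ^ j"
    proof -
      have "[:pCons q c:] = const2 q + [:c:] * var_x" by (simp add: const2_def var_x_def)
      then show ?thesis by (simp only: power_Suc algebra_simps)
    qed
    show ?case unfolding split by (rule add[OF monomial pCons.IH])
  qed
  have "P (F * var_y ^ j)" for j
  proof (induction F arbitrary: j)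
    case 0
    show ?case using zero by simp
  next
    case (pCons c F)
    have split: "pCons c F * var_y ^ j = [:c:] * var_x ^ 0 * var_y ^ j + F * var_y ^ Suc j"
    proof -
      have "pCons c F = [:c:] + F * var_y" by (simp add: var_y_def)
      then show ?thesis by (simp only: power_Suc power_0 algebra_simps mult_1_right)
    qed
    show ?case unfolding split by (rule add[OF inner pCons.IH])
  qed
  from this[of 0] show ?thesis by simp
qed

lemma ring_hom_fun_eval2: "ring_hom_fun (\<lambda>F. eval2 F x y)"
  unfolding eval2_def by (intro ring_hom_fun_subst2) (simp add: ring_hom_fun_def of_rat_add of_rat_mult)

lemma eval2_power: "eval2 (F ^ n) x y = eval2 F x y ^ n"
proof (induction n)
  case 0
  show ?case using ring_hom_fun_eval2 by (simp add: ring_hom_fun_def)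
qed (simp add: eval2_hom)

lemma eval2_0: "eval2 0 x y = 0"
  by (rule ring_hom_fun_0[OF ring_hom_fun_eval2])

lemma eval2_monomial: "eval2 (const2 c * var_x ^ i * var_y ^ j) x y = of_rat c * x ^ i * y ^ j"
  by (simp add: eval2_hom eval2_power)

lemma eval2_uminus: "eval2 (- F) x y = - eval2 F x y"
proof -
  have "eval2 (- F) x y + eval2 F x y = 0"
    by (simp add: eval2_hom(1)[symmetric] eval2_0)
  then show ?thesis by simp
qed

text \<open>
  Both sides are ring homomorphisms in \<open>F\<close> that agree on the generators. Invariance under
  \<^const>\<open>sigma_aut\<close> thus becomes invariance of the polynomial function under rotation by a right angle.
\<close>

lemma eval2_sigma_aut: "eval2 (sigma_aut F) x y = eval2 F (- y) x"
proof (rule rat_poly2_hom_unique)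
  show "ring_hom_fun (\<lambda>F. eval2 (sigma_aut F) x y)"
    using ring_hom_fun_eval2[of x y] ring_hom_fun_sigma_aut by (simp add: ring_hom_fun_def)
qed (simp_all add: ring_hom_fun_eval2 sigma_aut_generators eval2_hom eval2_uminus)

definition orbit_sum :: "rat poly poly \<Rightarrow> real \<times> real \<Rightarrow> real" where
  "orbit_sum H = (\<lambda>(x, y). eval2 H x y + eval2 H (- y) x + eval2 H (- x) (- y) + eval2 H y (- x))"

text \<open>
  For a monomial \<open>x ^ i * y ^ j\<close> the four terms of the orbit sum contribute, by the symmetry of the
  triangle in \<open>x\<close> and \<open>y\<close>, the integral of one monomial with the factor
  \<open>(1 + (-1) ^ i) * (1 + (-1) ^ j)\<close>. Hence only even exponents survive.
\<close>

lemma integral_orbit_sum: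
  assumes "t \<le> 2 * m"
  shows "set_integrable lborel std_triangle (\<lambda>z. integrand (2 * m) (2 * m) t z * orbit_sum H z)
    \<and> (LINT z:std_triangle|lborel. integrand (2 * m) (2 * m) t z * orbit_sum H z) \<in> catalan_span"
proof (induction H rule: rat_poly2_monomial_induct)
  case zero
  have "orbit_sum 0 = (\<lambda>z. 0)" by (auto simp: orbit_sum_def eval2_0)
  then show ?case by (simp add: set_integrable_def catalan_span_Rats set_lebesgue_integral_def)
next
  case (add H1 H2)
  have "(\<lambda>z. integrand (2 * m) (2 * m) t z * orbit_sum (H1 + H2) z)
      = (\<lambda>z. integrand (2 * m) (2 * m) t z * orbit_sum H1 z + integrand (2 * m) (2 * m) t z * orbit_sum H2 z)"
    by (auto simp: orbit_sum_def eval2_hom algebra_simps)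
  then show ?case
    using add by (simp add: set_integral_add catalan_span_add)
next
  case (monomial c i j)
  define s :: "nat \<Rightarrow> real" where "s = (\<lambda>k. (- 1) ^ k)"
  define I where "I = integrand (2 * m + i) (2 * m + j) t"
  define I' where "I' = integrand (2 * m + j) (2 * m + i) t"
  \<comment> \<open>The first and third terms of the orbit keep the exponents, the other two exchange them.\<close>
  have eq: "(\<lambda>z. integrand (2 * m) (2 * m) t z * orbit_sum (const2 c * var_x ^ i * var_y ^ j) z)
    = (\<lambda>z. of_rat c * (1 + s (i + j)) * I z + of_rat c * (s i + s j) * I' z)" (is "?L = ?R")
  proof
    fix z :: "real \<times> real"
    obtain x y where z: "z = (x, y)" by (cases z)
    define Q where "Q = (1 - x\<^sup>2 - y\<^sup>2) ^ (t + 1)"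
    have n: "(- x) ^ k = s k * x ^ k" "(- y) ^ k = s k * y ^ k" for k
      unfolding s_def by (rule power_minus)+
    have "x ^ (2 * m) * y ^ (2 * m) *
      (of_rat c * x ^ i * y ^ j + of_rat c * (s i * y ^ i) * x ^ j + of_rat c * (s i * x ^ i) * (s j * y ^ j)
         + of_rat c * y ^ i * (s j * x ^ j))
      = of_rat c * (1 + s (i + j)) * (x ^ (2 * m + i) * y ^ (2 * m + j))
        + of_rat c * (s i + s j) * (x ^ (2 * m + j) * y ^ (2 * m + i))"
      by (simp add: s_def power_add algebra_simps)
    from arg_cong[OF this, of "\<lambda>v. v / Q"] show "?L z = ?R z"
      unfolding I_def I'_def z integrand_def orbit_sum_def prod.case eval2_monomial n Q_def[symmetric]
      by (simp add: add_divide_distrib)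
  qed
  have I: "set_integrable lborel std_triangle I" "set_integrable lborel std_triangle I'"
    unfolding I_def I'_def using assms by (auto intro!: set_integrable_integrand)
  have int: "set_integrable lborel std_triangle (\<lambda>z. of_rat c * (1 + s (i + j)) * I z)"
    "set_integrable lborel std_triangle (\<lambda>z. of_rat c * (s i + s j) * I' z)"
    using I by (auto intro!: set_integrable_mult_right)
  have "(LINT z:std_triangle|lborel. ?R z)
      = of_rat c * (1 + s (i + j)) * period (2 * m + i) (2 * m + j) t
        + of_rat c * (s i + s j) * period (2 * m + j) (2 * m + i) t"
    unfolding set_integral_add(2)[OF int] by (simp add: period_def I_def I'_def)
  also have "\<dots> = of_rat c * ((1 + s i) * (1 + s j)) * period (2 * m + i) (2 * m + j) t"
    unfolding period_swap[of "2 * m + j" "2 * m + i"] by (simp add: s_def power_add algebra_simps)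
  also have "\<dots> \<in> catalan_span"
  proof (cases "even i \<and> even j")
    case True
    then obtain i' j' where ij: "i = 2 * i'" "j = 2 * j'" by (auto elim!: evenE)
    have "period (2 * (m + i')) (2 * (m + j')) t \<in> catalan_span"
      using assms by (intro period_in_catalan_span) auto
    then show ?thesis
      by (intro catalan_span_scale) (auto simp: s_def ij algebra_simps)
  next
    case False
    then have "(1 + s i) * (1 + s j) = 0" by (auto simp: s_def)
    then show ?thesis by (simp only: mult_zero_right mult_zero_left catalan_span_Rats Rats_0)
  qed
  finally show ?case
    unfolding eq using set_integral_add(1)[OF int] by simp
qed

theorem theorem1p1p1:
  fixes t :: nat and F :: "rat poly poly"
  assumes "sigma_aut F = F"
    and "var_x ^ (2 * nat \<lceil>real t / 2\<rceil>) * var_y ^ (2 * nat \<lceil>real t / 2\<rceil>) dvd F"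
  shows "set_integrable lborel std_triangle (\<lambda>(x, y). eval2 F x y / (1 - x\<^sup>2 - y\<^sup>2) ^ (t + 1)) \<and>
    (\<exists>a b :: rat.
      set_lebesgue_integral lborel std_triangle (\<lambda>(x, y). eval2 F x y / (1 - x\<^sup>2 - y\<^sup>2) ^ (t + 1))
        = of_rat a * 1 + of_rat b * catalan_const)"
proof -
  define m where "m = nat \<lceil>real t / 2\<rceil>"
  have m: "t \<le> 2 * m" unfolding m_def by linarith
  obtain H where H: "F = var_x ^ (2 * m) * var_y ^ (2 * m) * H"
    using assms(2) unfolding m_def by (elim dvdE)
  have rot: "eval2 F x y = eval2 F (- y) x" for x y
    using eval2_sigma_aut[of F x y] assms(1) by simp
  have F: "eval2 F x y = x ^ (2 * m) * y ^ (2 * m) * eval2 H x y" for x y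
    unfolding H by (simp add: eval2_hom eval2_power)
  \<comment> \<open>The factor \<open>x ^ (2 * m) * y ^ (2 * m)\<close> is itself invariant, so averaging \<open>F\<close> averages the cofactor.\<close>
  have avg: "eval2 F x y = x ^ (2 * m) * y ^ (2 * m) * ((1 / 4) * orbit_sum H (x, y))" for x y
  proof -
    have "4 * eval2 F x y = eval2 F x y + eval2 F (- y) x + eval2 F (- x) (- y) + eval2 F y (- x)"
      using rot[of x y] rot[of "- y" x] rot[of "- x" "- y"] by simp
    also have "\<dots> = x ^ (2 * m) * y ^ (2 * m) * orbit_sum H (x, y)"
      unfolding F orbit_sum_def by (simp add: algebra_simps)
    finally show ?thesis by simp
  qed
  have eq: "(\<lambda>(x, y). eval2 F x y / (1 - x\<^sup>2 - y\<^sup>2) ^ (t + 1))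
      = (\<lambda>z. (1 / 4) * (integrand (2 * m) (2 * m) t z * orbit_sum H z))"
    by (auto simp: avg integrand_def)
  note I = integral_orbit_sum[OF m, of H]
  have int: "set_integrable lborel std_triangle (\<lambda>z. (1 / 4) * (integrand (2 * m) (2 * m) t z * orbit_sum H z))"
    using I by (intro set_integrable_mult_right) auto
  have "(LINT z:std_triangle|lborel. (1 / 4) * (integrand (2 * m) (2 * m) t z * orbit_sum H z))
     = (1 / 4) * (LINT z:std_triangle|lborel. integrand (2 * m) (2 * m) t z * orbit_sum H z)"
    by (rule set_integral_mult_right)
  also have "\<dots> \<in> catalan_span"
    using I by (intro catalan_span_scale) auto
  finally show ?thesis
    unfolding eq using int by (auto simp: catalan_span_def)
qed

end
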